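(* Let $1\le i<j\le n$. If $X$ is the generic $n\times n$ matrix, then $\big((I_2(\widetilde X_{ij})+\langle g_i\rangle): g_j\big)=\langle x_{i1},\ldots,x_{in}\rangle$. If $X$ is the generic symmetric $n\times n$ matrix, then $\big((I_2(\widetilde X_{ij})+\langle g_i\rangle): g_j\big)=\langle x_{1i},\ldots,x_{i-1,i},x_{ii},\ldots,x_{in}\rangle$.
   Context: $K$ is a field, $n\ge2$. $X=(x_{ij})$ is an $n\times n$ matrix whose entries are indeterminates over $K$: in the generic case all $x_{ij}$ are independent; in the generic symmetric case $x_{ij}=x_{ji}$ and the $x_{ij}$ with $i\le j$ are independent. $Y=(y_1,\ldots,y_n)^t$ is a column of further independent indeterminates, and $R=K[x_{ij},y_j]$ is the polynomial ring in all these indeterminates. $g_r=\sum_{s=1}^n x_{rs}y_s$ is the $r$-th entry of $XY$. $\widetilde X_{ij}$ is the $2\times n$ matrix consisting of the $i$-th and $j$-th rows of $X$, and $I_2(\widetilde X_{ij})\subseteq R$ is the ideal generated by its $2\times2$ minors. For an ideal $L$ and $f\in R$, $(L:f)=\{h\in R\mid hf\in L\}$. *)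

theory Defs
  imports
    "HOL-Analysis.Determinants"
    "HOL-Library.Poly_Mapping"
    "HOL-Library.Set_Algebras"
    "HOL-Library.Uprod"
begin

text \<open>The polynomial ring over \<open>'k\<close> in the indeterminates \<open>'v\<close>: the monoid algebra of the
  finitely supported exponent functions.\<close>

type_synonym ('v, 'k) mpoly = "('v \<Rightarrow>\<^sub>0 nat) \<Rightarrow>\<^sub>0 'k"

definition Var :: "'v \<Rightarrow> ('v, 'k::comm_ring_1) mpoly"
  where "Var v = Poly_Mapping.single (Poly_Mapping.single v 1) 1"

text \<open>Row and column indices range over a finite linearly ordered type \<open>'n\<close> with \<open>n = CARD('n)\<close>.
  The matrix entries are indexed by \<open>'e\<close>: ordered pairs in the generic case, and unordered pairs
  (possibly with equal components) in the generic symmetric case, so that in each case the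
  polynomial ring has exactly one indeterminate for each independent entry.\<close>

datatype ('e, 'n) indet = Xvar 'e | Yvar 'n

definition generic_matrix :: "(('n \<times> 'n, 'n) indet, 'k::comm_ring_1) mpoly ^ 'n ^ 'n"
  where "generic_matrix = (\<chi> r s. Var (Xvar (r, s)))"

definition generic_symmetric_matrix :: "(('n uprod, 'n) indet, 'k::comm_ring_1) mpoly ^ 'n ^ 'n"
  where "generic_symmetric_matrix = (\<chi> r s. Var (Xvar (Upair r s)))"

definition y_column :: "(('e, 'n) indet, 'k::comm_ring_1) mpoly ^ 'n"
  where "y_column = (\<chi> s. Var (Yvar s))"

lemma module_mult: "module ((*) :: 'a::comm_ring_1 \<Rightarrow> 'a \<Rightarrow> 'a)"
  by unfold_locales (simp_all add: algebra_simps)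

text \<open>An ideal is a submodule of the ring regarded as a module over itself.\<close>

definition ideal_gen :: "'a::comm_ring_1 set \<Rightarrow> 'a set"
  where "ideal_gen S = module.span (*) S"

definition colon_ideal :: "'a::comm_ring_1 set \<Rightarrow> 'a \<Rightarrow> 'a set"
  where "colon_ideal L f = {h. h * f \<in> L}"

definition two_rows :: "'a::zero ^ 'n ^ 'm \<Rightarrow> 'm \<Rightarrow> 'm \<Rightarrow> 'a ^ 'n ^ 2"
  where "two_rows A i j = vector [row i A, row j A]"

definition I2 :: "'a::comm_ring_1 ^ ('n::{finite,linorder}) ^ 2 \<Rightarrow> 'a set"
  where "I2 M = ideal_gen {det (\<chi> r (c::2). M $ r $ (if c = 1 then k else l)) | k l. k < l}"

end

theory Submission
  imports Defs
begin

text \<open>Write \<open>a\<close> and \<open>b\<close> for the rows \<open>i\<close> and \<open>j\<close>, and let \<open>P\<close> be the ideal generated by the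
  entries of \<open>a\<close>. Expanding the minors gives
  \<open>a\<^sub>t g\<^sub>j = (\<Sum>s. (a\<^sub>t b\<^sub>s - a\<^sub>s b\<^sub>t) y\<^sub>s) + b\<^sub>t g\<^sub>i\<close>,
  so \<open>P\<close> is contained in the colon ideal, over any commutative ring
  (\<open>row_entry_mem_colon_ideal\<close>). Conversely, the minors and \<open>g\<^sub>i\<close> all lie in \<open>P\<close>, so it suffices
  that \<open>g\<^sub>j\<close> is a nonzerodivisor modulo \<open>P\<close>.

  Now \<open>P\<close> is generated by indeterminates, hence consists of the polynomials all of whose monomials
  involve one of these (\<open>mem_ideal_gen_Var_iff\<close>). Moreover \<open>g\<^sub>j = b\<^sub>j y\<^sub>j + r\<close> where the indeterminate
  \<open>b\<^sub>j = x\<^sub>j\<^sub>j\<close> is not a generator of \<open>P\<close> and does not occur in \<open>r\<close>. If \<open>h\<close> had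
  a monomial outside \<open>P\<close>, then one of maximal degree in \<open>b\<^sub>j\<close> would survive, multiplied by \<open>b\<^sub>j y\<^sub>j\<close>, in
  \<open>h g\<^sub>j\<close> (\<open>nonzerodivisor_mod_vars\<close>).

  In both cases the entries of the matrix are indeterminates such that \<open>x\<^sub>j\<^sub>j\<close> is missing from row
  \<open>i\<close> and occurs only once in row \<open>j\<close>, so one argument covers both
  (\<open>colon_ideal_indeterminate_rows\<close>). In the symmetric case the rows share the indeterminate
  \<open>x\<^sub>i\<^sub>j\<close>; the term \<open>x\<^sub>i\<^sub>j y\<^sub>i\<close> of \<open>g\<^sub>j\<close> then vanishes modulo \<open>P\<close>, but \<open>x\<^sub>j\<^sub>j y\<^sub>j\<close> does not.\<close>

section \<open>Ideals generated by a set\<close>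

lemma ideal_gen_superset: "x \<in> T \<Longrightarrow> x \<in> ideal_gen T"
  unfolding ideal_gen_def by (rule module.span_base[OF module_mult])

lemma ideal_gen_add: "x \<in> ideal_gen T \<Longrightarrow> y \<in> ideal_gen T \<Longrightarrow> x + y \<in> ideal_gen T"
  unfolding ideal_gen_def by (rule module.span_add[OF module_mult])

lemma ideal_gen_diff: "x \<in> ideal_gen T \<Longrightarrow> y \<in> ideal_gen T \<Longrightarrow> x - y \<in> ideal_gen T"
  unfolding ideal_gen_def by (rule module.span_diff[OF module_mult])

lemma ideal_gen_neg: "x \<in> ideal_gen T \<Longrightarrow> - x \<in> ideal_gen T"
  unfolding ideal_gen_def by (rule module.span_neg[OF module_mult])

lemma ideal_gen_mult_left: "x \<in> ideal_gen T \<Longrightarrow> c * x \<in> ideal_gen T"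
  unfolding ideal_gen_def by (rule module.span_scale[OF module_mult])

lemma ideal_gen_mult_right: "x \<in> ideal_gen T \<Longrightarrow> x * c \<in> ideal_gen T"
  using ideal_gen_mult_left[of x T c] by (simp add: mult.commute)

lemma ideal_gen_sum: "(\<And>x. x \<in> A \<Longrightarrow> f x \<in> ideal_gen T) \<Longrightarrow> sum f A \<in> ideal_gen T"
  unfolding ideal_gen_def by (rule module.span_sum[OF module_mult])

lemma ideal_gen_zero: "0 \<in> ideal_gen T"
  unfolding ideal_gen_def by (rule module.span_zero[OF module_mult])

lemma ideal_gen_induct [consumes 1, case_names zero step]:
  assumes "x \<in> ideal_gen T" and "P 0"
    and "\<And>c t y. t \<in> T \<Longrightarrow> P y \<Longrightarrow> P (c * t + y)"
  shows "P x"
  using module.span_induct_alt[OF module_mult assms(1)[unfolded ideal_gen_def], of P] assms(2,3)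
  by blast

lemma ideal_gen_minimal: "T \<subseteq> ideal_gen U \<Longrightarrow> ideal_gen T \<subseteq> ideal_gen U"
proof
  fix x assume T: "T \<subseteq> ideal_gen U" and "x \<in> ideal_gen T"
  from this(2) show "x \<in> ideal_gen U"
    by (induction rule: ideal_gen_induct)
      (use T in \<open>auto intro: ideal_gen_zero ideal_gen_add ideal_gen_mult_left\<close>)
qed

section \<open>Ideals generated by indeterminates\<close>

lemma poly_mapping_eq_sum_single:
  "p = (\<Sum>m\<in>Poly_Mapping.keys p. Poly_Mapping.single m (Poly_Mapping.lookup p m))"
  by (rule poly_mapping_eqI)
    (auto simp: lookup_sum lookup_single when_def sum.delta in_keys_iff)

lemma single_mult_Var:
  assumes "v \<in> Poly_Mapping.keys m"
  shows "Poly_Mapping.single (m - Poly_Mapping.single v 1) c * Var v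
    = (Poly_Mapping.single m c :: ('v, 'k::comm_ring_1) mpoly)"
proof -
  have "m - Poly_Mapping.single v 1 + Poly_Mapping.single v 1 = m"
    using assms
    by (intro poly_mapping_eqI)
      (auto simp: lookup_add lookup_minus lookup_single when_def in_keys_iff)
  then show ?thesis
    unfolding Var_def mult_single by simp
qed

lemma keys_add_nat_exponents:
  "Poly_Mapping.keys (m + n) = Poly_Mapping.keys m \<union> Poly_Mapping.keys (n :: 'v \<Rightarrow>\<^sub>0 nat)"
  by (auto simp: in_keys_iff lookup_add)

text \<open>The right-hand side is closed under the ideal operations because multiplying by a monomial
  never removes an indeterminate; conversely, any indeterminate of a monomial can be split off.\<close>

lemma mem_ideal_gen_Var_iff:
  fixes p :: "('v, 'k::comm_ring_1) mpoly"
  shows "p \<in> ideal_gen (Var ` A) \<longleftrightarrow>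
    (\<forall>m \<in> Poly_Mapping.keys p. Poly_Mapping.keys m \<inter> A \<noteq> {})"
proof
  assume "p \<in> ideal_gen (Var ` A)"
  then show "\<forall>m \<in> Poly_Mapping.keys p. Poly_Mapping.keys m \<inter> A \<noteq> {}"
  proof (induction rule: ideal_gen_induct)
    case zero
    then show ?case by simp
  next
    case (step c t y)
    then obtain v where v: "v \<in> A" "t = Var v" by blast
    have "Poly_Mapping.keys m \<inter> A \<noteq> {}" if m: "m \<in> Poly_Mapping.keys (c * t)" for m
    proof -
      obtain a where "m = a + Poly_Mapping.single v 1"
        using m keys_mult[of c t] by (auto simp: v Var_def split: if_splits)
      then show ?thesis
        using v(1) by (auto simp: keys_add_nat_exponents)
    qed
    then show ?case
      using step.IH keys_add[of "c * t" y] by blast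
  qed
next
  assume *: "\<forall>m \<in> Poly_Mapping.keys p. Poly_Mapping.keys m \<inter> A \<noteq> {}"
  have "Poly_Mapping.single m (Poly_Mapping.lookup p m) \<in> ideal_gen (Var ` A)"
    if "m \<in> Poly_Mapping.keys p" for m
  proof -
    obtain v where "v \<in> Poly_Mapping.keys m" "v \<in> A"
      using * \<open>m \<in> Poly_Mapping.keys p\<close> by blast
    then show ?thesis
      by (metis single_mult_Var ideal_gen_mult_left ideal_gen_superset imageI)
  qed
  then have "(\<Sum>m\<in>Poly_Mapping.keys p. Poly_Mapping.single m (Poly_Mapping.lookup p m))
      \<in> ideal_gen (Var ` A)"
    by (rule ideal_gen_sum)
  then show "p \<in> ideal_gen (Var ` A)"
    by (simp flip: poly_mapping_eq_sum_single)
qed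

lemma lookup_mult_single_one:
  fixes p :: "'m::cancel_comm_monoid_add \<Rightarrow>\<^sub>0 'k::comm_ring_1"
  shows "Poly_Mapping.lookup (p * Poly_Mapping.single e 1) (m + e) = Poly_Mapping.lookup p m"
proof -
  have "Sum_any (\<lambda>q. Poly_Mapping.lookup (Poly_Mapping.single e (1::'k)) q when m + e = l + q)
      = (1 when m = l)" for l
  proof -
    have "(\<lambda>q. Poly_Mapping.lookup (Poly_Mapping.single e (1::'k)) q when m + e = l + q)
        = (\<lambda>q. (1 when m = l) when q = e)"
      by (auto simp: lookup_single when_def fun_eq_iff)
    then show ?thesis by (simp only: Sum_any_when_equal)
  qed
  then show ?thesis
    by (simp add: lookup_mult mult_when)
qed

text \<open>Among the monomials of \<open>p\<close> that avoid \<open>A\<close>, let \<open>m\<close> have the largest degree in \<open>u\<close>. The monomial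
  \<open>m + e\<close> of \<open>p * f\<close> arises in no other way, since the terms of \<open>r\<close> have smaller degree in \<open>u\<close> than
  \<open>e\<close>. Hence its coefficient is that of \<open>m\<close> in \<open>p\<close>, although \<open>m + e\<close> avoids \<open>A\<close>. The degree in the
  one indeterminate \<open>u\<close> thus takes the place of a monomial order.\<close>

lemma nonzerodivisor_mod_vars:
  fixes p :: "('v, 'k::comm_ring_1) mpoly"
  assumes "p * f \<in> ideal_gen (Var ` A)"
    and f: "f = Poly_Mapping.single e 1 + r"
    and e: "Poly_Mapping.keys e \<inter> A = {}"
    and r: "\<And>m. m \<in> Poly_Mapping.keys r \<Longrightarrow> Poly_Mapping.lookup m u < Poly_Mapping.lookup e u"
  shows "p \<in> ideal_gen (Var ` A)"
proof (rule ccontr)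
  define B where "B = {m \<in> Poly_Mapping.keys p. Poly_Mapping.keys m \<inter> A = {}}"
  assume "p \<notin> ideal_gen (Var ` A)"
  then have "B \<noteq> {}" "finite B"
    unfolding mem_ideal_gen_Var_iff B_def by auto
  then obtain m where m: "m \<in> B"
    and max: "\<And>m'. m' \<in> B \<Longrightarrow> Poly_Mapping.lookup m' u \<le> Poly_Mapping.lookup m u"
    using obtains_MAX[of B "\<lambda>m. Poly_Mapping.lookup m u"] by (metis Max_ge finite_imageI imageI)
  have avoid: "Poly_Mapping.keys (m + e) \<inter> A = {}"
    using m e unfolding B_def keys_add_nat_exponents by blast
  have "m + e \<notin> Poly_Mapping.keys (p * r)"
  proof
    assume "m + e \<in> Poly_Mapping.keys (p * r)"
    then obtain a b where ab: "a \<in> Poly_Mapping.keys p" "b \<in> Poly_Mapping.keys r" "m + e = a + b"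
      using keys_mult[of p r] by blast
    then have "a \<in> B"
      using avoid unfolding B_def by (auto simp: keys_add_nat_exponents)
    then have "Poly_Mapping.lookup (a + b) u < Poly_Mapping.lookup (m + e) u"
      using max[of a] r[OF ab(2)] by (simp add: lookup_add)
    then show False
      using ab(3) by simp
  qed
  then have "Poly_Mapping.lookup (p * f) (m + e) = Poly_Mapping.lookup p m"
    by (simp add: f distrib_left lookup_add lookup_mult_single_one in_keys_iff)
  also have "\<dots> \<noteq> 0"
    using m unfolding B_def by (simp add: in_keys_iff)
  finally have "m + e \<in> Poly_Mapping.keys (p * f)"
    by (simp add: in_keys_iff)
  then show False
    using assms(1) avoid unfolding mem_ideal_gen_Var_iff by blast
qed

section \<open>Two rows of a matrix\<close>

lemma I2_two_rows:
  "I2 (two_rows M i j) = ideal_gen {M $ i $ k * M $ j $ l - M $ i $ l * M $ j $ k | k l. k < l}"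
proof -
  have "(1::2) \<noteq> 2" by simp
  then show ?thesis
    unfolding I2_def two_rows_def by (simp add: det_2 row_def mult.commute)
qed

lemma minor_mem_I2:
  "M $ i $ k * M $ j $ l - M $ i $ l * M $ j $ k \<in> I2 (two_rows M i j)"
proof (cases k l rule: linorder_cases)
  case less
  then show ?thesis
    unfolding I2_two_rows by (auto intro: ideal_gen_superset)
next
  case equal
  then show ?thesis
    unfolding I2_two_rows by (simp add: ideal_gen_zero)
next
  case greater
  then have "- (M $ i $ l * M $ j $ k - M $ i $ k * M $ j $ l) \<in> I2 (two_rows M i j)"
    unfolding I2_two_rows by (intro ideal_gen_neg ideal_gen_superset) auto
  then show ?thesis by simp
qed

text \<open>The identity displayed at the beginning: its sum consists of multiples of minors.\<close>

lemma row_entry_mem_colon_ideal: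
  fixes M :: "'a::comm_ring_1 ^ ('n::{finite,linorder}) ^ ('n::{finite,linorder})"
  shows "M $ i $ t \<in>
    colon_ideal (I2 (two_rows M i j) + ideal_gen {(M *v y) $ i}) ((M *v y) $ j)"
proof -
  have "M $ i $ t * (M *v y) $ j
      = (\<Sum>s\<in>UNIV. (M $ i $ t * M $ j $ s - M $ i $ s * M $ j $ t) * y $ s)
        + M $ j $ t * (M *v y) $ i"
    by (simp add: matrix_vector_mult_def sum_distrib_left sum_subtractf algebra_simps)
  moreover have "(\<Sum>s\<in>UNIV. (M $ i $ t * M $ j $ s - M $ i $ s * M $ j $ t) * y $ s)
      \<in> I2 (two_rows M i j)"
    using minor_mem_I2[of M i t j] unfolding I2_two_rows
    by (intro ideal_gen_sum ideal_gen_mult_right)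
  moreover have "M $ j $ t * (M *v y) $ i \<in> ideal_gen {(M *v y) $ i}"
    by (intro ideal_gen_mult_left ideal_gen_superset) simp
  ultimately show ?thesis
    unfolding colon_ideal_def by auto
qed

lemma colon_ideal_sum_add_multiple:
  assumes "p \<in> colon_ideal (ideal_gen T + ideal_gen U) f"
    and "q \<in> colon_ideal (ideal_gen T + ideal_gen U) f"
  shows "c * p + q \<in> colon_ideal (ideal_gen T + ideal_gen U) f"
proof -
  from assms obtain p1 p2 q1 q2 where eqs: "p * f = p1 + p2" "q * f = q1 + q2"
    and mem: "p1 \<in> ideal_gen T" "p2 \<in> ideal_gen U" "q1 \<in> ideal_gen T" "q2 \<in> ideal_gen U"
    unfolding colon_ideal_def by (auto elim!: set_plus_elim)
  have "(c * p + q) * f = c * (p * f) + q * f"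
    by (simp add: algebra_simps)
  also have "\<dots> = (c * p1 + q1) + (c * p2 + q2)"
    unfolding eqs by (simp add: algebra_simps)
  finally have "(c * p + q) * f = (c * p1 + q1) + (c * p2 + q2)" .
  moreover have "(c * p1 + q1) + (c * p2 + q2) \<in> ideal_gen T + ideal_gen U"
    using mem by (intro set_plus_intro ideal_gen_add ideal_gen_mult_left)
  ultimately show ?thesis
    unfolding colon_ideal_def by simp
qed

lemma row_ideal_subset_colon_ideal:
  fixes M :: "'a::comm_ring_1 ^ ('n::{finite,linorder}) ^ ('n::{finite,linorder})"
  shows "ideal_gen (range (($) (M $ i)))
    \<subseteq> colon_ideal (I2 (two_rows M i j) + ideal_gen {(M *v y) $ i}) ((M *v y) $ j)"
    (is "_ \<subseteq> ?C")
proof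
  fix p assume "p \<in> ideal_gen (range (($) (M $ i)))"
  then show "p \<in> ?C"
  proof (induction rule: ideal_gen_induct)
    case zero
    have "0 + 0 \<in> I2 (two_rows M i j) + ideal_gen {(M *v y) $ i}"
      unfolding I2_two_rows by (intro set_plus_intro ideal_gen_zero)
    then show ?case
      by (simp add: colon_ideal_def)
  next
    case (step c t q)
    then have "t \<in> ?C"
      using row_entry_mem_colon_ideal by blast
    then show ?case
      using step.IH unfolding I2_two_rows by (rule colon_ideal_sum_add_multiple)
  qed
qed

lemma minors_and_product_in_row_ideal:
  fixes M :: "'a::comm_ring_1 ^ ('n::{finite,linorder}) ^ ('n::{finite,linorder})"
  shows "I2 (two_rows M i j) + ideal_gen {(M *v y) $ i} \<subseteq> ideal_gen (range (($) (M $ i)))"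
proof -
  have entry: "M $ i $ s \<in> ideal_gen (range (($) (M $ i)))" for s
    by (simp add: ideal_gen_superset)
  have "I2 (two_rows M i j) \<subseteq> ideal_gen (range (($) (M $ i)))"
    unfolding I2_two_rows using entry
    by (intro ideal_gen_minimal) (auto intro!: ideal_gen_diff ideal_gen_mult_right)
  moreover have "ideal_gen {(M *v y) $ i} \<subseteq> ideal_gen (range (($) (M $ i)))"
    using entry
    by (intro ideal_gen_minimal)
      (auto simp: matrix_vector_mult_def intro!: ideal_gen_sum ideal_gen_mult_right)
  ultimately show ?thesis
    by (auto elim!: set_plus_elim intro: ideal_gen_add)
qed

section \<open>Matrices of indeterminates\<close>

text \<open>The assumptions make the degree in \<open>x j j\<close> single out the term \<open>x j j * y j\<close> of the \<open>j\<close>-th entry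
  of the product, and keep this term outside the ideal of row \<open>i\<close>. They allow repeated
  indeterminates elsewhere, as in a symmetric matrix.\<close>

lemma colon_ideal_indeterminate_rows:
  fixes x :: "'n::{finite,linorder} \<Rightarrow> 'n \<Rightarrow> 'e"
    and M :: "(('e, 'n) indet, 'k::comm_ring_1) mpoly ^ ('n::{finite,linorder}) ^ ('n::{finite,linorder})"
  assumes M: "M = (\<chi> r s. Var (Xvar (x r s)))"
    and row_i: "\<And>s. x i s \<noteq> x j j"
    and row_j: "\<And>s. s \<noteq> j \<Longrightarrow> x j s \<noteq> x j j"
  shows "colon_ideal (I2 (two_rows M i j) + ideal_gen {(M *v y_column) $ i}) ((M *v y_column) $ j)
    = ideal_gen (range (($) (M $ i)))"
proof (intro equalityI row_ideal_subset_colon_ideal subsetI)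
  fix h
  assume "h \<in> colon_ideal (I2 (two_rows M i j) + ideal_gen {(M *v y_column) $ i})
    ((M *v y_column) $ j)"
  then have "h * (M *v y_column) $ j \<in> ideal_gen (range (($) (M $ i)))"
    using minors_and_product_in_row_ideal unfolding colon_ideal_def by blast
  moreover have range_eq: "range (($) (M $ i)) = Var ` range (\<lambda>s. Xvar (x i s))"
    by (auto simp: M)
  ultimately have h: "h * (M *v y_column) $ j \<in> ideal_gen (Var ` range (\<lambda>s. Xvar (x i s)))"
    by simp
  \<comment> \<open>\<open>e s\<close> is the exponent of the monomial \<open>x j s * y s\<close>.\<close>
  define e :: "'n \<Rightarrow> ('e, 'n) indet \<Rightarrow>\<^sub>0 nat" where
    "e s = Poly_Mapping.single (Xvar (x j s)) 1 + Poly_Mapping.single (Yvar s) 1" for s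
  define r :: "(('e, 'n) indet, 'k) mpoly" where
    "r = (\<Sum>s\<in>UNIV - {j}. Poly_Mapping.single (e s) 1)"
  have "(M *v y_column) $ j = (\<Sum>s\<in>UNIV. Poly_Mapping.single (e s) 1)"
    by (simp add: M matrix_vector_mult_def y_column_def Var_def mult_single e_def)
  then have split: "(M *v y_column) $ j = Poly_Mapping.single (e j) 1 + r"
    by (simp add: r_def sum.remove[of UNIV j])
  have "Poly_Mapping.lookup m (Xvar (x j j)) < Poly_Mapping.lookup (e j) (Xvar (x j j))"
    if m: "m \<in> Poly_Mapping.keys r" for m
  proof -
    obtain s where "s \<noteq> j" "m = e s"
      using m keys_sum[of "\<lambda>s. Poly_Mapping.single (e s) (1::'k)" "UNIV - {j}"]
      by (auto simp: r_def)
    then show ?thesis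
      using row_j by (auto simp: e_def lookup_add lookup_single when_def)
  qed
  moreover have "Poly_Mapping.keys (e j) \<inter> range (\<lambda>s. Xvar (x i s)) = {}"
    using row_i by (auto simp: e_def keys_add_nat_exponents) metis
  ultimately show "h \<in> ideal_gen (range (($) (M $ i)))"
    using nonzerodivisor_mod_vars[OF h split] unfolding range_eq by blast
qed

theorem lemma6p3:
  fixes i j :: "'n::{finite,linorder}"
    and X :: "(('n \<times> 'n, 'n) indet, 'k::field) mpoly ^ ('n::{finite,linorder}) ^ ('n::{finite,linorder})"
    and S :: "(('n uprod, 'n) indet, 'k) mpoly ^ ('n::{finite,linorder}) ^ ('n::{finite,linorder})"
  assumes "CARD('n) \<ge> 2" and "i < j"
    and "X = generic_matrix" and "S = generic_symmetric_matrix"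
  shows "colon_ideal (I2 (two_rows X i j) + ideal_gen {(X *v y_column) $ i}) ((X *v y_column) $ j)
           = ideal_gen {X $ i $ s | s. True}
       \<and> colon_ideal (I2 (two_rows S i j) + ideal_gen {(S *v y_column) $ i}) ((S *v y_column) $ j)
           = ideal_gen ({S $ s $ i | s. s < i} \<union> {S $ i $ s | s. i \<le> s})"
proof
  show "colon_ideal (I2 (two_rows X i j) + ideal_gen {(X *v y_column) $ i}) ((X *v y_column) $ j)
      = ideal_gen {X $ i $ s | s. True}"
    using colon_ideal_indeterminate_rows[of X Pair i j] less_imp_neq[OF \<open>i < j\<close>]
    by (simp add: assms(3) generic_matrix_def full_SetCompr_eq)
next
  have "{S $ s $ i | s. s < i} \<union> {S $ i $ s | s. i \<le> s} = range (($) (S $ i))"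
  proof -
    have "S $ s $ i = S $ i $ s" for s
      by (auto simp: assms(4) generic_symmetric_matrix_def Upair_inject intro!: arg_cong[where f = Var])
    then show ?thesis
      by (auto simp: set_eq_iff) (metis not_less)
  qed
  moreover have "Upair i s \<noteq> Upair j j" for s
    using \<open>i < j\<close> by auto
  ultimately show "colon_ideal (I2 (two_rows S i j) + ideal_gen {(S *v y_column) $ i})
        ((S *v y_column) $ j)
      = ideal_gen ({S $ s $ i | s. s < i} \<union> {S $ i $ s | s. i \<le> s})"
    using colon_ideal_indeterminate_rows[of S Upair i j]
    by (simp add: assms(4) generic_symmetric_matrix_def)
qed

end
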